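(* Let $H = C_n\Omega \in \mathbb{C}^{2n\times 2n}$ be a definite Bethe–Salpeter Hamiltonian matrix with blocks $A, B \in \mathbb{C}^{n\times n}$. Suppose that $u_1\in\mathbb{C}^n$ satisfies $\operatorname{Re}(u_1^{\mathsf H}Au_1+u_1^{\mathsf H}B\overline{u}_1)=1$. Let $1\le k<n$, and apply a $k$-step Lanczos procedure to $H^2$ in the $\Omega$-inner product with starting vector $q_1=\begin{bmatrix}u_1\\ \overline{u}_1\end{bmatrix}$ (as described in the context), assuming that the procedure does not break down. Then the Lanczos vectors are of the form $q_j=\begin{bmatrix}u_j\\ \overline{u}_j\end{bmatrix}$ with $u_j\in\mathbb{C}^n$ for $1\le j\le k+1$, and the procedure produces $$H^2\begin{bmatrix}U_k\\ \overline{U}_k\end{bmatrix}=\begin{bmatrix}U_k\\ \overline{U}_k\end{bmatrix}T_k+\beta_k\begin{bmatrix}u_{k+1}\\ \overline{u}_{k+1}\end{bmatrix}e_k^{\mathsf H},$$ where $U_k=[u_1,\ldots,u_k]\in\mathbb{C}^{n\times k}$ and $T_k\in\mathbb{R}^{k\times k}$ is a real symmetric tridiagonal matrix with diagonal entries $\alpha_1,\ldots,\alpha_k$ and sub- and superdiagonal entries $\beta_1,\ldots,\beta_{k-1}$. The matrix $T_k$ is positive definite and componentwise nonnegative, and $\beta_k>0$. The Lanczos vectors satisfy the orthogonality condition $$\begin{bmatrix}u_i\\ \overline{u}_i\end{bmatrix}^{\mathsf H}\Omega\begin{bmatrix}u_j\\ \overline{u}_j\end{bmatrix}=2\delta_{ij},\qquad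 1\le i,j\le k+1,$$ where $\delta_{ij}$ is the Kronecker delta.
   Context: Notation: $\overline{M}$ is the entrywise complex conjugate, $M^{\mathsf H}$ the conjugate transpose, $e_k$ the $k$-th column of the $k\times k$ identity matrix. A Bethe–Salpeter Hamiltonian matrix is a matrix $H=\begin{bmatrix}A&B\\-\overline{B}&-\overline{A}\end{bmatrix}\in\mathbb{C}^{2n\times2n}$ with $A^{\mathsf H}=A$ and $\overline{B}^{\mathsf H}=B$ (i.e. $A$ is Hermitian and $B$ is complex symmetric). One writes $H=C_n\Omega$ with $$C_n=\begin{bmatrix}I_n&0\\0&-I_n\end{bmatrix},\qquad \Omega=\begin{bmatrix}A&B\\ \overline{B}&\overline{A}\end{bmatrix}.$$ $H$ is called definite if the Hermitian matrix $\Omega$ is positive definite. The $\Omega$-inner product on $\mathbb{C}^{2n}$ is $\langle x,y\rangle_\Omega=y^{\mathsf H}\Omega x$. The matrix $H^2=(C_n\Omega C_n)\Omega$ is self-adjoint and positive definite with respect to this inner product. Lanczos procedure for $H^2$ in the $\Omega$-inner product, with all vectors normalized so that $\langle q,q\rangle_\Omega=2$: starting from $q_1$ with $\langle q_1,q_1\rangle_\Omega=2$, for $j=1,\ldots,k$ set $t_{ij}=\tfrac12\langle H^2q_j,q_i\rangle_\Omega$ for $1\le i\le j$, $w_j=H^2q_j-\sum_{i=1}^{j}t_{ij}q_i$, $\beta_j=\big(\tfrac12\langle w_j,w_j\rangle_\Omega\big)^{1/2}$, and $q_{j+1}=w_j/\beta_j$. The procedure breaks down if $w_j=0$ for some $j\le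 k$. The vectors $q_1,\ldots,q_{k+1}$ are the Lanczos vectors, and the projected matrix $T_k$ is the $k\times k$ upper Hessenberg matrix with entries $t_{ij}$ for $i\le j$, subdiagonal entries $t_{j+1,j}=\beta_j$ ($1\le j\le k-1$), and zeros elsewhere; its diagonal entries are denoted $\alpha_j=t_{jj}$. *)

theory Defs
  imports "Jordan_Normal_Form.Schur_Decomposition"
begin

abbreviation conj_mat :: "complex mat \<Rightarrow> complex mat" where
  "conj_mat M \<equiv> map_mat cnj M"

text \<open>Over the reals \<^const>\<open>conjugate\<close> is the identity, so \<open>positive_definite\<close> also covers real
  symmetric positive definite matrices. Over the complex numbers \<open>0 < z\<close> means that \<open>z\<close> is a
  positive real number. Note that \<open>v \<bullet>c w\<close> conjugates its second argument, so
  \<open>(M *\<^sub>v x) \<bullet>c x\<close> is \<open>x\<^sup>H M x\<close>.\<close>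

definition hermitian :: "'a::conjugatable_field mat \<Rightarrow> bool" where
  "hermitian M \<longleftrightarrow> mat_adjoint M = M"

definition positive_definite :: "'a::conjugatable_ordered_field mat \<Rightarrow> bool" where
  "positive_definite M \<longleftrightarrow> hermitian M \<and>
     (\<forall>x \<in> carrier_vec (dim_row M). x \<noteq> 0\<^sub>v (dim_row M) \<longrightarrow> 0 < (M *\<^sub>v x) \<bullet>c x)"

definition C_mat :: "nat \<Rightarrow> complex mat" where
  "C_mat n = four_block_mat (1\<^sub>m n) (0\<^sub>m n n) (0\<^sub>m n n) (- 1\<^sub>m n)"

definition bs_Omega :: "complex mat \<Rightarrow> complex mat \<Rightarrow> complex mat" where
  "bs_Omega A B = four_block_mat A B (conj_mat B) (conj_mat A)"

definition bethe_salpeter :: "nat \<Rightarrow> complex mat \<Rightarrow> complex mat \<Rightarrow> complex mat \<Rightarrow> bool" where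
  "bethe_salpeter n A B H \<longleftrightarrow>
     A \<in> carrier_mat n n \<and> B \<in> carrier_mat n n \<and>
     mat_adjoint A = A \<and> mat_adjoint (conj_mat B) = B \<and>
     H = four_block_mat A B (- conj_mat B) (- conj_mat A)"

definition definite_bethe_salpeter ::
  "nat \<Rightarrow> complex mat \<Rightarrow> complex mat \<Rightarrow> complex mat \<Rightarrow> bool" where
  "definite_bethe_salpeter n A B H \<longleftrightarrow>
     bethe_salpeter n A B H \<and> positive_definite (bs_Omega A B)"

lemma bethe_salpeter_factorization:
  assumes "bethe_salpeter n A B H"
  shows "H = C_mat n * bs_Omega A B"
proof -
  have c: "A \<in> carrier_mat n n" "B \<in> carrier_mat n n"
    "conj_mat A \<in> carrier_mat n n" "conj_mat B \<in> carrier_mat n n"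
    using assms by (auto simp: bethe_salpeter_def)
  have z: "0\<^sub>m n n \<in> carrier_mat n n" "1\<^sub>m n \<in> carrier_mat n n" "- 1\<^sub>m n \<in> carrier_mat n n"
    by auto
  show ?thesis
    using assms c
    by (simp add: bethe_salpeter_def C_mat_def bs_Omega_def
        mult_four_block_mat[OF z(2) z(1) z(1) z(3) c(1,2,4,3)])
qed

text \<open>The inner product \<open>\<langle>x, y\<rangle>\<^sub>\<Omega> = y\<^sup>H \<Omega> x\<close>, linear in the first argument.\<close>

definition inner_wrt :: "complex mat \<Rightarrow> complex vec \<Rightarrow> complex vec \<Rightarrow> complex" where
  "inner_wrt \<Omega> x y = (\<Omega> *\<^sub>v x) \<bullet>c y"

text \<open>The quantities of the Lanczos procedure for a matrix \<open>M\<close> in the \<open>\<Omega>\<close>-inner product, as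
  functions of the (1-based) sequence \<open>q\<close> of Lanczos vectors; \<open>lanczos_w\<close> and \<open>lanczos_beta\<close>
  at \<open>j\<close> only use \<open>q 1, \<dots>, q j\<close>.
  For a Hermitian positive definite \<open>\<Omega>\<close>, \<open>inner_wrt \<Omega> w w\<close> is real and nonnegative, so taking the
  real part in \<open>lanczos_beta\<close> loses nothing.\<close>

definition lanczos_t :: "complex mat \<Rightarrow> complex mat \<Rightarrow> (nat \<Rightarrow> complex vec) \<Rightarrow> nat \<Rightarrow> nat \<Rightarrow> complex"
  where "lanczos_t M \<Omega> q i j = 1/2 * inner_wrt \<Omega> (M *\<^sub>v q j) (q i)"

definition lanczos_w :: "complex mat \<Rightarrow> complex mat \<Rightarrow> (nat \<Rightarrow> complex vec) \<Rightarrow> nat \<Rightarrow> complex vec"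
  where "lanczos_w M \<Omega> q j =
    M *\<^sub>v q j - finsum_vec TYPE(complex) (dim_row M) (\<lambda>i. lanczos_t M \<Omega> q i j \<cdot>\<^sub>v q i) {1..j}"

definition lanczos_beta :: "complex mat \<Rightarrow> complex mat \<Rightarrow> (nat \<Rightarrow> complex vec) \<Rightarrow> nat \<Rightarrow> real"
  where "lanczos_beta M \<Omega> q j =
    sqrt (1/2 * Re (inner_wrt \<Omega> (lanczos_w M \<Omega> q j) (lanczos_w M \<Omega> q j)))"

text \<open>\<open>q 1, \<dots>, q (k + 1)\<close> are the vectors produced by \<open>k\<close> steps of the procedure started at \<open>q\<^sub>1\<close>;
  they are determined by these equations. Without the separate condition \<open>lanczos_no_breakdown\<close>
  the division by \<open>lanczos_beta\<close> may be a division by zero. Values of \<open>q\<close> outside \<open>{1..k + 1}\<close> are irrelevant. The normalisation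
  \<open>inner_wrt \<Omega> q\<^sub>1 q\<^sub>1 = 2\<close> of the starting vector is not part of these definitions.\<close>

definition lanczos_vectors ::
  "complex mat \<Rightarrow> complex mat \<Rightarrow> complex vec \<Rightarrow> nat \<Rightarrow> (nat \<Rightarrow> complex vec) \<Rightarrow> bool" where
  "lanczos_vectors M \<Omega> q\<^sub>1 k q \<longleftrightarrow> q 1 = q\<^sub>1 \<and>
     (\<forall>j \<in> {1..k}. q (j + 1) =
        (1 / complex_of_real (lanczos_beta M \<Omega> q j)) \<cdot>\<^sub>v lanczos_w M \<Omega> q j)"

definition lanczos_no_breakdown ::
  "complex mat \<Rightarrow> complex mat \<Rightarrow> nat \<Rightarrow> (nat \<Rightarrow> complex vec) \<Rightarrow> bool" where
  "lanczos_no_breakdown M \<Omega> k q \<longleftrightarrow> (\<forall>j \<in> {1..k}. lanczos_w M \<Omega> q j \<noteq> 0\<^sub>v (dim_row M))"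

text \<open>Matrix indices are 0-based, the sequences of coefficients 1-based.\<close>

definition lanczos_T :: "complex mat \<Rightarrow> complex mat \<Rightarrow> (nat \<Rightarrow> complex vec) \<Rightarrow> nat \<Rightarrow> complex mat"
  where "lanczos_T M \<Omega> q k = mat k k (\<lambda>(i, j).
    if i \<le> j then lanczos_t M \<Omega> q (i + 1) (j + 1)
    else if i = j + 1 then complex_of_real (lanczos_beta M \<Omega> q (j + 1))
    else 0)"

definition sym_tridiagonal :: "nat \<Rightarrow> (nat \<Rightarrow> real) \<Rightarrow> (nat \<Rightarrow> real) \<Rightarrow> real mat" where
  "sym_tridiagonal k \<alpha> \<beta> = mat k k (\<lambda>(i, j).
    if i = j then \<alpha> (i + 1)
    else if i = j + 1 then \<beta> (j + 1)
    else if j = i + 1 then \<beta> (i + 1)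
    else 0)"

abbreviation stack_conj :: "complex vec \<Rightarrow> complex vec" where
  "stack_conj u \<equiv> u @\<^sub>v conjugate u"

abbreviation stack_conj_mat :: "complex mat \<Rightarrow> complex mat" where
  "stack_conj_mat U \<equiv> U @\<^sub>r conj_mat U"

abbreviation col_mat :: "complex vec \<Rightarrow> complex mat" where
  "col_mat v \<equiv> mat_of_cols (dim_vec v) [v]"

end

theory Submission
  imports Defs
begin

text \<open>
  Both \<open>\<Omega>\<close> and \<open>C_n\<close> are Hermitian, so \<open>H = C_n \<Omega>\<close> is self-adjoint in the
  \<open>\<Omega>\<close>-inner product, and \<open>\<langle>H\<^sup>2 x, x\<rangle> = \<langle>H x, H x\<rangle> > 0\<close> for \<open>x \<noteq> 0\<close>.
  For any self-adjoint matrix the Lanczos vectors are orthogonal, and the projected matrix, being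
  both Hermitian and upper Hessenberg with real subdiagonal, is real symmetric tridiagonal; it is
  half the Gram matrix of the form \<open>\<langle>H\<^sup>2 x, y\<rangle>\<close> on the Lanczos vectors, hence positive
  definite. Since the coefficients are real and \<open>H\<^sup>2\<close> preserves the real subspace of the vectors
  \<open>(u, cnj u)\<close>, all Lanczos vectors stay in that subspace.
\<close>

section \<open>Adjoint matrices and the standard inner product\<close>

lemma mat_adjoint_carrier [simp]:
  "A \<in> carrier_mat m n \<Longrightarrow> mat_adjoint A \<in> carrier_mat n m"
  by (auto simp: mat_adjoint_def)

lemma dim_mat_adjoint [simp]:
  "dim_row (mat_adjoint A) = dim_col A" "dim_col (mat_adjoint A) = dim_row A"
  by (auto simp: mat_adjoint_def)

lemma index_mat_adjoint [simp]:
  "i < dim_col A \<Longrightarrow> j < dim_row A \<Longrightarrow> mat_adjoint A $$ (i, j) = conjugate (A $$ (j, i))"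
  by (simp add: mat_adjoint_def mat_of_rows_index)

lemma mat_adjoint_inner:
  fixes A :: "'a::conjugatable_field mat"
  assumes "A \<in> carrier_mat m n" "x \<in> carrier_vec n" "y \<in> carrier_vec m"
  shows "(A *\<^sub>v x) \<bullet>c y = x \<bullet>c (mat_adjoint A *\<^sub>v y)"
proof -
  have "(A *\<^sub>v x) \<bullet>c y = (\<Sum>i<m. \<Sum>j<n. A $$ (i, j) * x $ j * conjugate (y $ i))"
    using assms by (simp add: scalar_prod_def sum_distrib_right atLeast0LessThan)
  also have "\<dots> = (\<Sum>j<n. \<Sum>i<m. A $$ (i, j) * x $ j * conjugate (y $ i))"
    by (rule sum.swap)
  also have "\<dots> = x \<bullet>c (mat_adjoint A *\<^sub>v y)"
    using assms by (simp add: scalar_prod_def sum_distrib_left atLeast0LessThan sum_conjugate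
        conjugate_dist_mul mult_ac)
  finally show ?thesis .
qed

lemma smult_mat_mult_vec:
  fixes A :: "'a::comm_ring mat"
  assumes "A \<in> carrier_mat m n" "x \<in> carrier_vec n"
  shows "(c \<cdot>\<^sub>m A) *\<^sub>v x = c \<cdot>\<^sub>v (A *\<^sub>v x)"
  using assms by (intro eq_vecI) (auto simp: scalar_prod_def sum_distrib_left mult_ac)

lemma mat_adjoint_mat_adjoint [simp]: "mat_adjoint (mat_adjoint A) = A"
  by (intro eq_matI) auto

lemma inner_conjugate_commute:
  fixes x y :: "complex vec"
  assumes "x \<in> carrier_vec n" "y \<in> carrier_vec n"
  shows "y \<bullet>c x = cnj (x \<bullet>c y)"
  using assms by (simp add: scalar_prod_def mult_ac)

section \<open>The inner product given by a positive definite matrix\<close>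

locale hermitian_form =
  fixes N :: nat and \<Omega> :: "complex mat"
  assumes form_carrier: "\<Omega> \<in> carrier_mat N N"
    and form_pos_def: "positive_definite \<Omega>"
begin

lemma form_adjoint: "mat_adjoint \<Omega> = \<Omega>"
  using form_pos_def by (simp add: positive_definite_def hermitian_def)

lemma form_commute:
  assumes "x \<in> carrier_vec N" "y \<in> carrier_vec N"
  shows "inner_wrt \<Omega> y x = cnj (inner_wrt \<Omega> x y)"
proof -
  have "inner_wrt \<Omega> y x = y \<bullet>c (\<Omega> *\<^sub>v x)"
    using mat_adjoint_inner[OF form_carrier assms(2,1)] by (simp add: inner_wrt_def form_adjoint)
  also have "\<dots> = cnj ((\<Omega> *\<^sub>v x) \<bullet>c y)"
    using assms form_carrier by (intro inner_conjugate_commute[of _ N]) auto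
  finally show ?thesis by (simp add: inner_wrt_def)
qed

lemma form_add_left:
  assumes "x \<in> carrier_vec N" "y \<in> carrier_vec N" "z \<in> carrier_vec N"
  shows "inner_wrt \<Omega> (x + y) z = inner_wrt \<Omega> x z + inner_wrt \<Omega> y z"
  using assms form_carrier
  by (simp add: inner_wrt_def mult_add_distrib_mat_vec add_scalar_prod_distrib[of _ N])

lemma form_diff_left:
  assumes "x \<in> carrier_vec N" "y \<in> carrier_vec N" "z \<in> carrier_vec N"
  shows "inner_wrt \<Omega> (x - y) z = inner_wrt \<Omega> x z - inner_wrt \<Omega> y z"
  using assms form_carrier
  by (simp add: inner_wrt_def mult_minus_distrib_mat_vec minus_scalar_prod_distrib[of _ N])

lemma form_smult_left:
  assumes "x \<in> carrier_vec N" "z \<in> carrier_vec N"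
  shows "inner_wrt \<Omega> (c \<cdot>\<^sub>v x) z = c * inner_wrt \<Omega> x z"
  using assms form_carrier
  by (simp add: inner_wrt_def mult_mat_vec[of _ N N] smult_scalar_prod_distrib[of _ N])

lemma form_smult_right:
  assumes "x \<in> carrier_vec N" "z \<in> carrier_vec N"
  shows "inner_wrt \<Omega> z (c \<cdot>\<^sub>v x) = cnj c * inner_wrt \<Omega> z x"
  using assms by (simp add: form_commute[of _ z] form_smult_left)

lemma form_zero_left [simp]:
  assumes "z \<in> carrier_vec N"
  shows "inner_wrt \<Omega> (0\<^sub>v N) z = 0"
  proof -
  have "0 \<cdot>\<^sub>v 0\<^sub>v N = (0\<^sub>v N :: complex vec)" by auto
  then show ?thesis
    using form_smult_left[OF zero_carrier_vec assms, of 0] by simp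
qed

lemma form_finsum_left:
  assumes "finite I" "f \<in> I \<rightarrow> carrier_vec N" "z \<in> carrier_vec N"
  shows "inner_wrt \<Omega> (finsum_vec TYPE(complex) N f I) z = (\<Sum>i\<in>I. inner_wrt \<Omega> (f i) z)"
  using assms
proof (induction I rule: finite_induct)
  case empty
  then show ?case by (simp add: finsum_vec_empty)
next
  case (insert i I)
  have "finsum_vec TYPE(complex) N f I \<in> carrier_vec N"
    using insert by (intro finsum_vec_closed) auto
  with insert show ?case
    by (subst finsum_vec_insert) (auto simp: form_add_left)
qed

lemma form_pos:
  assumes "x \<in> carrier_vec N" "x \<noteq> 0\<^sub>v N"
  shows "0 < inner_wrt \<Omega> x x"
  using assms form_pos_def form_carrier by (auto simp: positive_definite_def inner_wrt_def)

end

section \<open>The Lanczos procedure for a general self-adjoint matrix\<close>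

locale lanczos_run = hermitian_form +
  fixes M :: "complex mat" and k :: nat and q :: "nat \<Rightarrow> complex vec"
  assumes M_carrier: "M \<in> carrier_mat N N"
    and self_adjoint: "x \<in> carrier_vec N \<Longrightarrow> y \<in> carrier_vec N \<Longrightarrow>
      inner_wrt \<Omega> (M *\<^sub>v x) y = inner_wrt \<Omega> x (M *\<^sub>v y)"
    and start_carrier: "q 1 \<in> carrier_vec N"
    and start_normalized: "inner_wrt \<Omega> (q 1) (q 1) = 2"
    and vectors: "lanczos_vectors M \<Omega> (q 1) k q"
    and no_breakdown: "lanczos_no_breakdown M \<Omega> k q"
begin

abbreviation "t \<equiv> lanczos_t M \<Omega> q"
abbreviation "w \<equiv> lanczos_w M \<Omega> q"
abbreviation "\<beta> \<equiv> lanczos_beta M \<Omega> q"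

lemma q_Suc:
  assumes "j \<in> {1..k}"
  shows "q (j + 1) = (1 / complex_of_real (\<beta> j)) \<cdot>\<^sub>v w j"
  using vectors assms by (auto simp: lanczos_vectors_def)

lemma w_carrier:
  assumes "\<forall>i\<in>{1..j}. q i \<in> carrier_vec N" "1 \<le> j"
  shows "w j \<in> carrier_vec N"
  using assms M_carrier unfolding lanczos_w_def
  by (auto intro!: minus_carrier_vec finsum_vec_closed)

text \<open>Since \<open>w j\<close> involves all of \<open>q 1\<close>, ..., \<open>q j\<close>,
  the induction carries the claim for the whole initial segment. \<open>orthogonal_upto\<close> and
  \<open>q_conj_symmetric_upto\<close> have the same shape.\<close>

lemma q_carrier_upto: "j \<le> k + 1 \<Longrightarrow> \<forall>i\<in>{1..j}. q i \<in> carrier_vec N"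
proof (induction j)
  case 0
  show ?case by simp
next
  case (Suc j)
  then have IH: "\<forall>i\<in>{1..j}. q i \<in> carrier_vec N" by simp
  have "q (Suc j) \<in> carrier_vec N"
  \<comment> \<open>Passing from 0 to 1 concerns the start vector, as the sequence is 1-based; the
    recurrence takes over from \<open>j = 1\<close> on.\<close>
  proof (cases "j = 0")
    case True
    then show ?thesis using start_carrier by simp
  next
    case False
    then show ?thesis using Suc.prems q_Suc[of j] w_carrier[OF IH] by simp
  qed
  with IH show ?case by (auto simp: le_Suc_eq)
qed

lemma q_carrier: "i \<in> {1..k + 1} \<Longrightarrow> q i \<in> carrier_vec N"
  using q_carrier_upto[of "k + 1"] by blast

lemma w_closed: "j \<in> {1..k} \<Longrightarrow> w j \<in> carrier_vec N"
  using q_carrier by (intro w_carrier) auto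

lemma inner_w_pos: "j \<in> {1..k} \<Longrightarrow> 0 < inner_wrt \<Omega> (w j) (w j)"
  using no_breakdown M_carrier w_closed
  by (intro form_pos) (auto simp: lanczos_no_breakdown_def)

text \<open>Without breakdown \<open>w j\<close> is nonzero and so has positive norm. From here on
  the division by \<beta> in the procedure is a genuine one.\<close>

lemma beta_pos: "j \<in> {1..k} \<Longrightarrow> 0 < \<beta> j"
  using inner_w_pos[of j] by (simp add: lanczos_beta_def less_complex_def)

text \<open>The real part in \<open>lanczos_beta\<close> loses nothing: positivity in the order of
  the complex numbers includes a vanishing imaginary part.\<close>

lemma inner_w_self:
  assumes "j \<in> {1..k}"
  shows "inner_wrt \<Omega> (w j) (w j) = 2 * complex_of_real (\<beta> j) ^ 2"
proof (rule complex_eqI)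
  show "Re (inner_wrt \<Omega> (w j) (w j)) = Re (2 * complex_of_real (\<beta> j) ^ 2)"
    using inner_w_pos[OF assms]
    by (simp add: lanczos_beta_def less_complex_def flip: of_real_power)
  show "Im (inner_wrt \<Omega> (w j) (w j)) = Im (2 * complex_of_real (\<beta> j) ^ 2)"
    using inner_w_pos[OF assms] by (simp add: less_complex_def flip: of_real_power)
qed

lemma finsum_closed:
  assumes "j \<in> {1..k}"
  shows "finsum_vec TYPE(complex) N (\<lambda>i. t i j \<cdot>\<^sub>v q i) {1..j} \<in> carrier_vec N"
  using assms q_carrier by (intro finsum_vec_closed) auto

lemma inner_w:
  assumes "j \<in> {1..k}" "y \<in> carrier_vec N"
  shows "inner_wrt \<Omega> (w j) y =
    inner_wrt \<Omega> (M *\<^sub>v q j) y - (\<Sum>i\<in>{1..j}. t i j * inner_wrt \<Omega> (q i) y)"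
proof -
  have "inner_wrt \<Omega> (w j) y = inner_wrt \<Omega> (M *\<^sub>v q j) y -
      inner_wrt \<Omega> (finsum_vec TYPE(complex) N (\<lambda>i. t i j \<cdot>\<^sub>v q i) {1..j}) y"
    using M_carrier assms q_carrier[of j] finsum_closed[OF assms(1)]
    by (simp add: lanczos_w_def form_diff_left)
  also have "inner_wrt \<Omega> (finsum_vec TYPE(complex) N (\<lambda>i. t i j \<cdot>\<^sub>v q i) {1..j}) y =
      (\<Sum>i\<in>{1..j}. inner_wrt \<Omega> (t i j \<cdot>\<^sub>v q i) y)"
    using assms q_carrier by (intro form_finsum_left) auto
  also have "\<dots> = (\<Sum>i\<in>{1..j}. t i j * inner_wrt \<Omega> (q i) y)"
    using assms q_carrier by (intro sum.cong refl form_smult_left) auto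
  finally show ?thesis .
qed

text \<open>This is Gram-Schmidt: \<open>w j\<close> is what remains of
  \<open>M *\<^sub>v q j\<close> after removing its projections onto all earlier vectors. The factor
  1/2 in \<open>t\<close> compensates for their squared norm 2.\<close>

lemma orthogonal_upto:
  "j \<le> k + 1 \<Longrightarrow> \<forall>a\<in>{1..j}. \<forall>b\<in>{1..j}. inner_wrt \<Omega> (q a) (q b) = (if a = b then 2 else 0)"
proof (induction j)
  case 0
  show ?case by simp
next
  case (Suc j)
  show ?case
  proof (cases "j = 0")
    case True
    then show ?thesis using start_normalized by simp
  next
    case False
    then have j: "j \<in> {1..k}" using Suc.prems by auto
    have IH: "inner_wrt \<Omega> (q a) (q b) = (if a = b then 2 else 0)"
      if "a \<in> {1..j}" "b \<in> {1..j}" for a b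
      using Suc that by simp
    note closed = q_carrier[of "Suc j"] w_closed[OF j]
    have q: "q (Suc j) = (1 / complex_of_real (\<beta> j)) \<cdot>\<^sub>v w j"
      using q_Suc[OF j] by simp
    have new: "inner_wrt \<Omega> (q (Suc j)) (q b) = 0" if b: "b \<in> {1..j}" for b
    proof -
      have "q b \<in> carrier_vec N" using b j by (intro q_carrier) auto
      \<comment> \<open>By the induction hypothesis only the term \<open>i = b\<close> survives, and
        \<open>2 * t b j\<close> is exactly the inner product of \<open>M *\<^sub>v q j\<close> with
        \<open>q b\<close>, so the two cancel.\<close>
      moreover have "(\<Sum>i\<in>{1..j}. t i j * inner_wrt \<Omega> (q i) (q b)) =
          (\<Sum>i\<in>{1..j}. if i = b then 2 * t b j else 0)"
        using IH b by (intro sum.cong) auto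
      ultimately have "inner_wrt \<Omega> (w j) (q b) = 0"
        using b by (simp add: inner_w[OF j] lanczos_t_def)
      then show ?thesis
        using closed \<open>q b \<in> carrier_vec N\<close> by (simp add: q form_smult_left)
    qed
    have new': "inner_wrt \<Omega> (q b) (q (Suc j)) = 0" if b: "b \<in> {1..j}" for b
      using form_commute[of "q (Suc j)" "q b"] new[OF b] q_carrier b j by simp
    have self: "inner_wrt \<Omega> (q (Suc j)) (q (Suc j)) = 2"
      using closed(2) beta_pos[OF j]
      by (simp add: q form_smult_left form_smult_right inner_w_self[OF j] power2_eq_square)
    show ?thesis
      using IH new new' self by (auto simp: le_Suc_eq)
  qed
qed

lemma orthogonal:
  assumes "a \<in> {1..k + 1}" "b \<in> {1..k + 1}"
  shows "inner_wrt \<Omega> (q a) (q b) = (if a = b then 2 else 0)"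
  using orthogonal_upto[of "k + 1"] assms by blast

lemma beta_smult_q:
  assumes "j \<in> {1..k}"
  shows "complex_of_real (\<beta> j) \<cdot>\<^sub>v q (j + 1) = w j"
  unfolding q_Suc[OF assms] using beta_pos[OF assms] by (simp add: smult_smult_assoc)

text \<open>The defining equation of \<open>w j\<close> solved for \<open>M *\<^sub>v q j\<close>.
  It is kept componentwise to fit the entrywise comparison in
  \<open>matrix_recurrence\<close>.\<close>

lemma index_recurrence:
  assumes j: "j \<in> {1..k}" and r: "r < N"
  shows "(M *\<^sub>v q j) $ r =
    (\<Sum>i\<in>{1..j}. t i j * q i $ r) + complex_of_real (\<beta> j) * q (j + 1) $ r"
proof -
  have d: "dim_vec (q i) = N" if "i \<in> {1..k + 1}" for i
    using q_carrier[OF that] by auto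
  have "finsum_vec TYPE(complex) N (\<lambda>i. t i j \<cdot>\<^sub>v q i) {1..j} $ r =
      (\<Sum>i\<in>{1..j}. (t i j \<cdot>\<^sub>v q i) $ r)"
    using j r q_carrier by (intro index_finsum_vec) auto
  also have "\<dots> = (\<Sum>i\<in>{1..j}. t i j * q i $ r)"
    using j r d by (intro sum.cong) auto
  finally have fs: "finsum_vec TYPE(complex) N (\<lambda>i. t i j \<cdot>\<^sub>v q i) {1..j} $ r = \<dots>" .
  have "complex_of_real (\<beta> j) * q (j + 1) $ r = w j $ r"
    using r j d[of "j + 1"] by (simp flip: beta_smult_q[OF j])
  also have "\<dots> = (M *\<^sub>v q j) $ r - (\<Sum>i\<in>{1..j}. t i j * q i $ r)"
    using r M_carrier finsum_closed[OF j] by (simp add: lanczos_w_def fs[simplified])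
  finally show ?thesis by simp
qed

text \<open>Up to \<open>a = j\<close> this is the definition of \<open>t\<close>. Beyond that,
  orthogonality removes the whole sum from the recurrence and leaves only the contribution of
  \<open>q (j + 1)\<close>.\<close>

lemma inner_recurrence:
  assumes j: "j \<in> {1..k}" and a: "a \<in> {1..k + 1}"
  shows "inner_wrt \<Omega> (M *\<^sub>v q j) (q a) =
    (if a \<le> j then 2 * t a j else if a = j + 1 then 2 * complex_of_real (\<beta> j) else 0)"
proof (cases "a \<le> j")
  case True
  then show ?thesis by (simp add: lanczos_t_def)
next
  case False
  have "(\<Sum>i\<in>{1..j}. t i j * inner_wrt \<Omega> (q i) (q a)) = 0"
    using False j a by (intro sum.neutral) (auto simp: orthogonal)
  moreover have "inner_wrt \<Omega> (w j) (q a) =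
      complex_of_real (\<beta> j) * inner_wrt \<Omega> (q (j + 1)) (q a)"
    using j a by (simp add: q_carrier form_smult_left flip: beta_smult_q[OF j])
  ultimately show ?thesis
    using False j a inner_w[OF j q_carrier[OF a]] by (auto simp: orthogonal)
qed

text \<open>Self-adjointness of \<open>M\<close> enters here. The pairs below the diagonal, which
  the procedure itself never computes, are included.\<close>

lemma t_hermitian:
  assumes "i \<in> {1..k + 1}" "j \<in> {1..k + 1}"
  shows "t j i = cnj (t i j)"
  using assms self_adjoint[of "q j" "q i"] form_commute[of "M *\<^sub>v q i" "q j"] M_carrier q_carrier
  by (simp add: lanczos_t_def)

text \<open>Taking the real part is harmless: \<open>t_hermitian\<close> forces \<open>t j j\<close>
  to be real, which \<open>t_entries\<close> records.\<close>

definition \<alpha> :: "nat \<Rightarrow> real" where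
  "\<alpha> j = Re (t j j)"

text \<open>Below the diagonal \<open>inner_recurrence\<close> leaves only \<beta> next to the
  diagonal. Hermitian symmetry reflects this to the upper part, where conjugation does not change
  the real number \<beta>.\<close>

lemma t_entries:
  assumes "i \<in> {1..k}" "j \<in> {1..k}"
  shows "t i j = (if i = j then complex_of_real (\<alpha> i)
    else if i = j + 1 then complex_of_real (\<beta> j)
    else if j = i + 1 then complex_of_real (\<beta> i) else 0)"
proof -
  have lower: "t a b = (if a = b + 1 then complex_of_real (\<beta> b) else 0)"
    if "a \<in> {1..k}" "b \<in> {1..k}" "b < a" for a b
    using inner_recurrence[of b a] that by (auto simp: lanczos_t_def)
  have "t i i = complex_of_real (\<alpha> i)"
    using t_hermitian[of i i] assms by (auto simp: \<alpha>_def complex_eq_iff)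
  moreover have "t i j = cnj (t j i)"
    using t_hermitian[of j i] assms by auto
  ultimately show ?thesis
    using lower[of i j] lower[of j i] assms by (cases i j rule: linorder_cases) auto
qed

lemma lanczos_T_tridiagonal:
  "lanczos_T M \<Omega> q k = map_mat complex_of_real (sym_tridiagonal k \<alpha> \<beta>)"
  by (rule eq_matI) (auto simp: lanczos_T_def sym_tridiagonal_def t_entries)

lemma tridiagonal_entry:
  assumes "i < k" "j < k"
  shows "complex_of_real (sym_tridiagonal k \<alpha> \<beta> $$ (i, j)) = t (i + 1) (j + 1)"
  using assms by (auto simp: sym_tridiagonal_def t_entries)

section \<open>Gram matrices of the Lanczos basis and signs of the projected matrix\<close>

definition Q :: "complex mat" where
  "Q = mat_of_cols N (map q [1..<k + 1])"

lemma Q_carrier: "Q \<in> carrier_mat N k"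
  using mat_of_cols_carrier(1)[of N "map q [1..<k + 1]"] by (simp add: Q_def del: upt_Suc)

lemma col_Q: "j < k \<Longrightarrow> col Q j = q (j + 1)"
  using q_carrier[of "j + 1"] by (simp add: Q_def del: upt_Suc)

lemma index_Q: "r < N \<Longrightarrow> j < k \<Longrightarrow> Q $$ (r, j) = q (j + 1) $ r"
  by (simp add: Q_def mat_of_cols_index del: upt_Suc)

text \<open>Used with \<open>X = \<Omega>\<close> for orthogonality and with
  \<open>X = \<Omega> * M\<close> for the projected matrix. The indices appear reversed because
  \<open>\<bullet>c\<close> conjugates its second argument.\<close>

lemma gram_entry:
  assumes "i < k" "j < k" "X \<in> carrier_mat N N"
  shows "(mat_adjoint Q * (X * Q)) $$ (i, j) = (X *\<^sub>v q (j + 1)) \<bullet>c q (i + 1)"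
proof -
  have "row (mat_adjoint Q) i = conjugate (q (i + 1))"
    using assms Q_carrier q_carrier[of "i + 1"] by (intro eq_vecI) (auto simp: index_Q)
  moreover have "col (X * Q) j = X *\<^sub>v q (j + 1)"
    using assms by (simp add: col_mult2[OF assms(3) Q_carrier] col_Q)
  moreover have "X *\<^sub>v q (j + 1) \<in> carrier_vec N"
    using assms q_carrier[of "j + 1"] by simp
  moreover have "(mat_adjoint Q * (X * Q)) $$ (i, j) = row (mat_adjoint Q) i \<bullet> col (X * Q) j"
    using assms carrier_matD[OF Q_carrier] by simp
  ultimately show ?thesis
    using assms q_carrier[of "i + 1"] comm_scalar_prod[of "conjugate (q (i + 1))" N "X *\<^sub>v q (j + 1)"]
    by simp
qed

text \<open>Moving \<open>Q\<close> across the inner product as its adjoint turns a quadratic form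
  on the range of \<open>Q\<close> into one on coefficient vectors.\<close>

lemma gram_form:
  assumes X: "X \<in> carrier_mat N N" and x: "x \<in> carrier_vec k"
  shows "(X *\<^sub>v (Q *\<^sub>v x)) \<bullet>c (Q *\<^sub>v x) = ((mat_adjoint Q * (X * Q)) *\<^sub>v x) \<bullet>c x"
proof -
  have XQ: "X * Q \<in> carrier_mat N k" using X Q_carrier by simp
  have "((mat_adjoint Q * (X * Q)) *\<^sub>v x) \<bullet>c x = (mat_adjoint Q *\<^sub>v ((X * Q) *\<^sub>v x)) \<bullet>c x"
    using x XQ Q_carrier by (simp add: assoc_mult_mat_vec[of _ k N])
  also have "\<dots> = ((X * Q) *\<^sub>v x) \<bullet>c (Q *\<^sub>v x)"
    using x XQ Q_carrier by (subst mat_adjoint_inner[of _ k N]) auto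
  also have "(X * Q) *\<^sub>v x = X *\<^sub>v (Q *\<^sub>v x)"
    using x X Q_carrier by (simp add: assoc_mult_mat_vec[of _ N N])
  finally show ?thesis by simp
qed

text \<open>For a real coefficient vector \<open>x\<close> put \<open>z = Q x\<close>. Orthogonality
  keeps \<open>z\<close> nonzero when \<open>x\<close> is, and the form of \<open>M\<close> at
  \<open>z\<close> is twice the form of \<open>T\<close> at \<open>x\<close>.\<close>

lemma tridiagonal_positive_definite:
  assumes M_pos: "\<And>z. z \<in> carrier_vec N \<Longrightarrow> z \<noteq> 0\<^sub>v N \<Longrightarrow> 0 < inner_wrt \<Omega> (M *\<^sub>v z) z"
  shows "positive_definite (sym_tridiagonal k \<alpha> \<beta>)"
proof -
  define T where "T = sym_tridiagonal k \<alpha> \<beta>"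
  let ?T = "map_mat complex_of_real T"
  have T: "T \<in> carrier_mat k k" by (simp add: T_def sym_tridiagonal_def)
  have "hermitian T"
    unfolding hermitian_def by (rule eq_matI) (auto simp: T_def sym_tridiagonal_def)
  moreover have "0 < (T *\<^sub>v x) \<bullet>c x" if x: "x \<in> carrier_vec k" "x \<noteq> 0\<^sub>v k" for x
  proof -
    let ?x = "map_vec complex_of_real x" and ?z = "Q *\<^sub>v map_vec complex_of_real x"
    have x': "?x \<in> carrier_vec k" using x by simp
    have z: "?z \<in> carrier_vec N" using Q_carrier x by simp
    \<comment> \<open>\<open>T\<close> is real while \<open>Q\<close> is complex, so
      \<open>x\<close> is embedded into the complex vectors; conjugation has no effect on its
      image.\<close>
    have of_real_inner: "complex_of_real (a \<bullet> b) =
        map_vec complex_of_real a \<bullet>c map_vec complex_of_real b"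
      if "a \<in> carrier_vec k" "b \<in> carrier_vec k" for a b
      using that by (simp add: scalar_prod_def)
    \<comment> \<open>Orthogonality as a Gram matrix. It makes the squared norm of \<open>?z\<close>
      twice that of \<open>?x\<close>, whence \<open>?z\<close> is nonzero.\<close>
    have "mat_adjoint Q * (\<Omega> * Q) = 2 \<cdot>\<^sub>m 1\<^sub>m k"
    proof (rule eq_matI)
      fix i j assume "i < dim_row (2 \<cdot>\<^sub>m 1\<^sub>m k :: complex mat)" "j < dim_col (2 \<cdot>\<^sub>m 1\<^sub>m k :: complex mat)"
      then show "(mat_adjoint Q * (\<Omega> * Q)) $$ (i, j) = (2 \<cdot>\<^sub>m 1\<^sub>m k) $$ (i, j)"
        using gram_entry[OF _ _ form_carrier, of i j] orthogonal[of "j + 1" "i + 1"]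
        by (auto simp: inner_wrt_def)
    qed (use Q_carrier in auto)
    then have "inner_wrt \<Omega> ?z ?z = 2 * (?x \<bullet>c ?x)"
      using gram_form[OF form_carrier x'] x'
      by (simp add: inner_wrt_def smult_mat_mult_vec[of _ k k])
    moreover have "?x \<bullet>c ?x = complex_of_real (x \<bullet> x)"
      using x by (simp add: of_real_inner)
    moreover have "x \<bullet> x \<noteq> 0"
      using x conjugate_square_eq_0_vec[of x k] by simp
    ultimately have "inner_wrt \<Omega> ?z ?z \<noteq> 0" by simp
    then have z0: "?z \<noteq> 0\<^sub>v N"
      by auto
    \<comment> \<open>With \<open>M\<close> inserted, the Gram entries are the numbers
      \<open>2 * t\<close>, that is, the entries of \<open>2 T\<close>.\<close>
    have "mat_adjoint Q * (\<Omega> * M * Q) = 2 \<cdot>\<^sub>m ?T"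
    proof (rule eq_matI)
      fix i j assume ij: "i < dim_row (2 \<cdot>\<^sub>m ?T)" "j < dim_col (2 \<cdot>\<^sub>m ?T)"
      then have "(mat_adjoint Q * (\<Omega> * M * Q)) $$ (i, j) = inner_wrt \<Omega> (M *\<^sub>v q (j + 1)) (q (i + 1))"
        using gram_entry[of i j "\<Omega> * M"] form_carrier M_carrier T q_carrier[of "j + 1"]
        by (simp add: inner_wrt_def assoc_mult_mat_vec[of _ N N])
      also have "\<dots> = 2 * t (i + 1) (j + 1)" by (simp add: lanczos_t_def)
      also have "\<dots> = (2 \<cdot>\<^sub>m ?T) $$ (i, j)"
        using ij T tridiagonal_entry[of i j] by (simp add: T_def)
      finally show "(mat_adjoint Q * (\<Omega> * M * Q)) $$ (i, j) = (2 \<cdot>\<^sub>m ?T) $$ (i, j)" .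
    qed (use Q_carrier T in auto)
    then have "inner_wrt \<Omega> (M *\<^sub>v ?z) ?z = 2 * ((?T *\<^sub>v ?x) \<bullet>c ?x)"
      using gram_form[of "\<Omega> * M" ?x] x' z form_carrier M_carrier T
      by (simp add: inner_wrt_def smult_mat_mult_vec[of _ k k] assoc_mult_mat_vec[of _ N N]
          smult_scalar_prod_distrib[of _ k])
    also have "?T *\<^sub>v ?x = map_vec complex_of_real (T *\<^sub>v x)"
      using T x by (simp add: of_real_hom.mult_mat_vec_hom)
    also have "map_vec complex_of_real (T *\<^sub>v x) \<bullet>c ?x = complex_of_real ((T *\<^sub>v x) \<bullet> x)"
      using T x by (intro of_real_inner[symmetric]) auto
    finally show ?thesis
      using M_pos[OF z z0] by (simp add: less_complex_def)
  qed
  ultimately show ?thesis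
    using T unfolding T_def[symmetric] positive_definite_def by auto
qed

text \<open>A diagonal entry is half the form of \<open>M\<close> at \<open>q j\<close>, and
  \<open>q j\<close> is nonzero because its squared norm is 2.\<close>

lemma diagonal_nonneg:
  assumes M_pos: "\<And>z. z \<in> carrier_vec N \<Longrightarrow> z \<noteq> 0\<^sub>v N \<Longrightarrow> 0 < inner_wrt \<Omega> (M *\<^sub>v z) z"
    and j: "j \<in> {1..k}"
  shows "0 \<le> \<alpha> j"
proof -
  have "q j \<noteq> 0\<^sub>v N"
    using orthogonal[of j j] j by auto
  then show ?thesis
    using M_pos[of "q j"] q_carrier[of j] j by (auto simp: \<alpha>_def lanczos_t_def less_complex_def)
qed

lemma tridiagonal_nonneg:
  assumes "\<And>z. z \<in> carrier_vec N \<Longrightarrow> z \<noteq> 0\<^sub>v N \<Longrightarrow> 0 < inner_wrt \<Omega> (M *\<^sub>v z) z"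
    and "i < k" "j < k"
  shows "0 \<le> sym_tridiagonal k \<alpha> \<beta> $$ (i, j)"
  using assms diagonal_nonneg[OF assms(1), of "i + 1"] beta_pos[of "i + 1"] beta_pos[of "j + 1"]
  by (auto simp: sym_tridiagonal_def)

text \<open>Column \<open>c\<close> is the recurrence for \<open>q (c + 1)\<close>. The subdiagonal
  of \<open>T\<close> supplies its last term, except in the last column, where that entry would lie
  outside \<open>T\<close> and the rank-one matrix provides it.\<close>

lemma matrix_recurrence:
  assumes "1 \<le> k"
  shows "M * Q = Q * map_mat complex_of_real (sym_tridiagonal k \<alpha> \<beta>) +
    complex_of_real (\<beta> k) \<cdot>\<^sub>m
      (col_mat (q (k + 1)) * mat_adjoint (col_mat (unit_vec k (k - 1))))"
proof -
  define T where "T = map_mat complex_of_real (sym_tridiagonal k \<alpha> \<beta>)"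
  let ?c = "col_mat (q (k + 1))" and ?e = "mat_adjoint (col_mat (unit_vec k (k - 1)))"
  have qd: "dim_vec (q (k + 1)) = N" using q_carrier[of "k + 1"] by simp
  note [simp] = carrier_matD[OF Q_carrier] carrier_matD[OF M_carrier] qd[simplified]
  have Td [simp]: "dim_row T = k" "dim_col T = k" by (simp_all add: T_def sym_tridiagonal_def)
  have "M * Q = Q * T + complex_of_real (\<beta> k) \<cdot>\<^sub>m (?c * ?e)"
  proof (rule eq_matI)
    show "dim_row (M * Q) = dim_row (Q * T + complex_of_real (\<beta> k) \<cdot>\<^sub>m (?c * ?e))"
      "dim_col (M * Q) = dim_col (Q * T + complex_of_real (\<beta> k) \<cdot>\<^sub>m (?c * ?e))"
      by auto
    fix r c
    assume "r < dim_row (Q * T + complex_of_real (\<beta> k) \<cdot>\<^sub>m (?c * ?e))"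
      "c < dim_col (Q * T + complex_of_real (\<beta> k) \<cdot>\<^sub>m (?c * ?e))"
    then have r: "r < N" and c: "c < k" by auto
    \<comment> \<open>The Hessenberg description of \<open>T\<close> is used instead of the
      tridiagonal one, so that the sum over \<open>i \<le> c\<close> matches
      \<open>index_recurrence\<close> term by term.\<close>
    have T_entry: "T $$ (i, c) = (if i \<le> c then t (i + 1) (c + 1)
        else if i = c + 1 then complex_of_real (\<beta> (c + 1)) else 0)" if "i < k" for i
      using that c by (simp add: T_def lanczos_T_def flip: lanczos_T_tridiagonal)
    have "(Q * T) $$ (r, c) = (\<Sum>i<k. q (i + 1) $ r * T $$ (i, c))"
      using r c by (simp add: scalar_prod_def index_Q atLeast0LessThan)
    also have "\<dots> = (\<Sum>i<k. (if i \<in> {..c} then t (i + 1) (c + 1) * q (i + 1) $ r else 0) +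
        (if i = c + 1 then complex_of_real (\<beta> (c + 1)) * q (c + 2) $ r else 0))"
      by (intro sum.cong) (auto simp: T_entry)
    \<comment> \<open>Row \<open>c + 1\<close> exists in \<open>T\<close> only for
      \<open>c + 1 < k\<close>, which is where the case distinction comes from.\<close>
    also have "\<dots> = (\<Sum>i\<in>{..c}. t (i + 1) (c + 1) * q (i + 1) $ r) +
        (if c + 1 < k then complex_of_real (\<beta> (c + 1)) * q (c + 2) $ r else 0)"
    proof -
      have "{..<k} \<inter> {..c} = {..c}" using c by auto
      then show ?thesis
        by (simp only: sum.distrib sum.inter_restrict[symmetric] finite_lessThan) (simp add: sum.delta)
    qed
    also have "(\<Sum>i\<in>{..c}. t (i + 1) (c + 1) * q (i + 1) $ r) =
        (\<Sum>i\<in>{1..c + 1}. t i (c + 1) * q i $ r)"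
      by (rule sum.reindex_bij_witness[of _ "\<lambda>i. i - 1" "\<lambda>i. i + 1"]) auto
    finally have QT: "(Q * T) $$ (r, c) = (\<Sum>i\<in>{1..c + 1}. t i (c + 1) * q i $ r) +
        (if c + 1 < k then complex_of_real (\<beta> (c + 1)) * q (c + 2) $ r else 0)" .
    \<comment> \<open>The vector \<open>e_k\<close> has its one at the 0-based position
      \<open>k - 1\<close>, so this matrix is zero outside the last column.\<close>
    have R: "(?c * ?e) $$ (r, c) = (if c + 1 = k then q (k + 1) $ r else 0)"
      using r c by (auto simp: scalar_prod_def mat_of_cols_index)
    have "(M * Q) $$ (r, c) = (M *\<^sub>v q (c + 1)) $ r"
      using r c by (simp add: col_Q)
    also have "\<dots> = (\<Sum>i\<in>{1..c + 1}. t i (c + 1) * q i $ r) +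
        complex_of_real (\<beta> (c + 1)) * q (c + 2) $ r"
      using index_recurrence[of "c + 1" r] r c by simp
    also have "\<dots> = (Q * T + complex_of_real (\<beta> k) \<cdot>\<^sub>m (?c * ?e)) $$ (r, c)"
    proof -
      \<comment> \<open>The two products must stay folded, so that \<open>QT\<close> and
        \<open>R\<close> can rewrite them.\<close>
      have split: "(Q * T + complex_of_real (\<beta> k) \<cdot>\<^sub>m (?c * ?e)) $$ (r, c) =
          (Q * T) $$ (r, c) + complex_of_real (\<beta> k) * (?c * ?e) $$ (r, c)"
        using r c by (simp del: index_mult_mat(1))
      show ?thesis
      proof (cases "c + 1 = k")
        case True
        then have "c + 2 = k + 1" by simp
        then show ?thesis unfolding split QT R True by simp
      next
        case False
        then show ?thesis unfolding split QT R using c by simp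
      qed
    qed
    finally show "(M * Q) $$ (r, c) = \<dots>" .
  qed
  then show ?thesis by (simp add: T_def)
qed

end

section \<open>The real subspace of conjugate-symmetric vectors\<close>

definition conj_symmetric :: "nat \<Rightarrow> complex vec \<Rightarrow> bool" where
  "conj_symmetric n v \<longleftrightarrow> v \<in> carrier_vec (n + n) \<and> (\<forall>i<n. v $ (n + i) = cnj (v $ i))"

lemma conj_symmetric_stack: "u \<in> carrier_vec n \<Longrightarrow> conj_symmetric n (stack_conj u)"
  by (auto simp: conj_symmetric_def)

text \<open>Converse of \<open>conj_symmetric_stack\<close>: the predicate describes exactly the
  vectors \<open>stack_conj u\<close>, and its componentwise form makes closure properties
  easy.\<close>

lemma stack_vec_first:
  assumes "conj_symmetric n v"
  shows "stack_conj (vec_first v n) = v"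
proof (rule eq_vecI)
  fix i assume i: "i < dim_vec v"
  show "stack_conj (vec_first v n) $ i = v $ i"
  proof (cases "i < n")
    case False
    then have "v $ (n + (i - n)) = cnj (v $ (i - n))"
      using assms i unfolding conj_symmetric_def by (metis carrier_vecD less_diff_conv2 not_less)
    with False show ?thesis
      using assms i by (auto simp: conj_symmetric_def vec_first_def)
  qed (use assms i in \<open>auto simp: conj_symmetric_def vec_first_def\<close>)
qed (use assms in \<open>auto simp: conj_symmetric_def vec_first_def\<close>)

text \<open>The scalar has to be real, since conjugation acts on it in the second half. This is why
  the Lanczos coefficients must be known to be real first.\<close>

lemma conj_symmetric_smult_real:
  "conj_symmetric n v \<Longrightarrow> conj_symmetric n (complex_of_real c \<cdot>\<^sub>v v)"
  by (auto simp: conj_symmetric_def)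

lemma conj_symmetric_diff:
  "conj_symmetric n v \<Longrightarrow> conj_symmetric n w \<Longrightarrow> conj_symmetric n (v - w)"
  by (auto simp: conj_symmetric_def)

lemma conj_symmetric_finsum:
  assumes "finite I" "\<And>i. i \<in> I \<Longrightarrow> conj_symmetric n (f i)"
  shows "conj_symmetric n (finsum_vec TYPE(complex) (n + n) f I)"
proof -
  have "f \<in> I \<rightarrow> carrier_vec (n + n)"
    using assms(2) by (auto simp: conj_symmetric_def)
  with assms show ?thesis
    by (auto simp: conj_symmetric_def index_finsum_vec intro!: finsum_vec_closed sum.cong)
qed

section \<open>Conjugated matrices and the signature matrix \<open>C_mat\<close>\<close>

lemma conj_mat_mult_conjugate:
  assumes "M \<in> carrier_mat m n" "v \<in> carrier_vec n"
  shows "conj_mat M *\<^sub>v conjugate v = conjugate (M *\<^sub>v v)"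
  using assms by (intro eq_vecI) (auto simp: scalar_prod_def)

lemma conj_mat_mult:
  assumes "M \<in> carrier_mat m n" "v \<in> carrier_vec n"
  shows "conj_mat M *\<^sub>v v = conjugate (M *\<^sub>v conjugate v)"
  using conj_mat_mult_conjugate[OF assms(1), of "conjugate v"] assms(2) by simp

lemma mat_mult_uminus_vec:
  fixes M :: "'a::comm_ring mat"
  assumes "M \<in> carrier_mat m n" "v \<in> carrier_vec n"
  shows "M *\<^sub>v (- v) = - (M *\<^sub>v v)"
  using assms by (intro eq_vecI) (auto simp: scalar_prod_def sum_negf)

lemma C_mat_carrier [simp]: "C_mat n \<in> carrier_mat (n + n) (n + n)"
  by (simp add: C_mat_def)

lemma C_mat_adjoint: "mat_adjoint (C_mat n) = C_mat n"
  by (rule eq_matI) (auto simp: C_mat_def)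

lemma C_mat_involution:
  assumes "x \<in> carrier_vec (n + n)"
  shows "C_mat n *\<^sub>v (C_mat n *\<^sub>v x) = x"
proof -
  have z: "0\<^sub>m n n \<in> carrier_mat n n" "1\<^sub>m n \<in> carrier_mat n n" "- 1\<^sub>m n \<in> carrier_mat n n"
    by auto
  have "- 0\<^sub>m n n = (0\<^sub>m n n :: complex mat)"
    by (rule eq_matI) auto
  then have "C_mat n * C_mat n = 1\<^sub>m (n + n)"
    by (simp add: C_mat_def mult_four_block_mat[OF z(2,1,1,3) z(2,1,1,3)] four_block_one_mat)
  then show ?thesis
    using assms by (simp flip: assoc_mult_mat_vec[OF C_mat_carrier C_mat_carrier])
qed

section \<open>Definite Bethe-Salpeter matrices\<close>

locale definite_bs =
  fixes n :: nat and A B H :: "complex mat"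
  assumes definite: "definite_bethe_salpeter n A B H"
begin

abbreviation "\<Omega> \<equiv> bs_Omega A B"

lemma blocks [simp]: "A \<in> carrier_mat n n" "B \<in> carrier_mat n n"
  and H_blocks: "H = four_block_mat A B (- conj_mat B) (- conj_mat A)"
  and Omega_pos_def: "positive_definite \<Omega>"
  using definite by (auto simp: definite_bethe_salpeter_def bethe_salpeter_def)

lemma H_factor: "H = C_mat n * \<Omega>"
  using definite by (auto simp: definite_bethe_salpeter_def bethe_salpeter_factorization)

lemma Omega_carrier [simp]: "\<Omega> \<in> carrier_mat (n + n) (n + n)"
  unfolding bs_Omega_def by (intro four_block_carrier_mat) auto

lemma H_carrier [simp]: "H \<in> carrier_mat (n + n) (n + n)"
  unfolding H_factor by (rule mult_carrier_mat[OF C_mat_carrier Omega_carrier])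

sublocale hermitian_form "n + n" \<Omega>
  using Omega_pos_def by unfold_locales auto

lemma H_mult: "x \<in> carrier_vec (n + n) \<Longrightarrow> H *\<^sub>v x = C_mat n *\<^sub>v (\<Omega> *\<^sub>v x)"
  unfolding H_factor by (rule assoc_mult_mat_vec[OF C_mat_carrier Omega_carrier])

lemma H_square: "H ^\<^sub>m 2 = H * H"
  by (simp add: numeral_2_eq_2)

lemma H_square_mult: "x \<in> carrier_vec (n + n) \<Longrightarrow> (H ^\<^sub>m 2) *\<^sub>v x = H *\<^sub>v (H *\<^sub>v x)"
  unfolding H_square by (rule assoc_mult_mat_vec[OF H_carrier H_carrier])

lemma H_mult_carrier [simp]: "x \<in> carrier_vec (n + n) \<Longrightarrow> H *\<^sub>v x \<in> carrier_vec (n + n)"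
  by (rule mult_mat_vec_carrier) auto

lemma Omega_mult_carrier [simp]: "x \<in> carrier_vec (n + n) \<Longrightarrow> \<Omega> *\<^sub>v x \<in> carrier_vec (n + n)"
  by (rule mult_mat_vec_carrier) auto

lemma C_mult_carrier [simp]: "x \<in> carrier_vec (n + n) \<Longrightarrow> C_mat n *\<^sub>v x \<in> carrier_vec (n + n)"
  by (rule mult_mat_vec_carrier) auto

lemma Omega_inner:
  assumes "x \<in> carrier_vec (n + n)" "y \<in> carrier_vec (n + n)"
  shows "(\<Omega> *\<^sub>v x) \<bullet>c y = x \<bullet>c (\<Omega> *\<^sub>v y)"
  using mat_adjoint_inner[OF Omega_carrier assms] by (simp add: form_adjoint)

lemma C_inner:
  assumes "x \<in> carrier_vec (n + n)" "y \<in> carrier_vec (n + n)"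
  shows "(C_mat n *\<^sub>v x) \<bullet>c y = x \<bullet>c (C_mat n *\<^sub>v y)"
  using mat_adjoint_inner[OF C_mat_carrier assms] by (simp add: C_mat_adjoint)

text \<open>Both sides are the sesquilinear form of \<Omega> C \<Omega>, which is Hermitian because
  \<Omega> and C are.\<close>

lemma H_self_adjoint:
  assumes "x \<in> carrier_vec (n + n)" "y \<in> carrier_vec (n + n)"
  shows "inner_wrt \<Omega> (H *\<^sub>v x) y = inner_wrt \<Omega> x (H *\<^sub>v y)"
  using assms by (simp add: inner_wrt_def H_mult Omega_inner C_inner)

lemma H_square_self_adjoint:
  assumes "x \<in> carrier_vec (n + n)" "y \<in> carrier_vec (n + n)"
  shows "inner_wrt \<Omega> ((H ^\<^sub>m 2) *\<^sub>v x) y = inner_wrt \<Omega> x ((H ^\<^sub>m 2) *\<^sub>v y)"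
  using assms by (simp add: H_square_mult H_self_adjoint)

text \<open>Pairing \<open>H *\<^sub>v x\<close> with \<open>C_mat n *\<^sub>v x\<close> cancels the
  two factors \<open>C_mat n\<close> and leaves the squared \<Omega>-norm of
  \<open>x\<close>.\<close>

lemma H_mult_nonzero:
  assumes x: "x \<in> carrier_vec (n + n)" "x \<noteq> 0\<^sub>v (n + n)"
  shows "H *\<^sub>v x \<noteq> 0\<^sub>v (n + n)"
proof
  assume "H *\<^sub>v x = 0\<^sub>v (n + n)"
  moreover have "(H *\<^sub>v x) \<bullet>c (C_mat n *\<^sub>v x) = inner_wrt \<Omega> x x"
    using x by (simp add: inner_wrt_def H_mult C_inner C_mat_involution)
  ultimately have "inner_wrt \<Omega> x x = 0"
    using C_mult_carrier[OF x(1)] by simp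
  with form_pos[OF x] show False by simp
qed

text \<open>Supplies the positivity premise of \<open>tridiagonal_positive_definite\<close> and
  \<open>tridiagonal_nonneg\<close> for \<open>M = H ^\<^sub>m 2\<close>.\<close>

lemma H_square_pos:
  assumes "x \<in> carrier_vec (n + n)" "x \<noteq> 0\<^sub>v (n + n)"
  shows "0 < inner_wrt \<Omega> ((H ^\<^sub>m 2) *\<^sub>v x) x"
  using assms form_pos[OF H_mult_carrier H_mult_nonzero]
  by (simp add: H_square_mult H_self_adjoint)

text \<open>The lower half is expressed through \<open>A\<close> and \<open>B\<close> so that it can
  be compared with the upper one: it is minus its conjugate for \<open>v = conjugate u\<close>, and
  its conjugate for \<open>v = - conjugate u\<close>.\<close>

lemma H_mult_append:
  assumes "u \<in> carrier_vec n" "v \<in> carrier_vec n"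
  shows "H *\<^sub>v (u @\<^sub>v v) =
    (A *\<^sub>v u + B *\<^sub>v v) @\<^sub>v (- conjugate (B *\<^sub>v conjugate u + A *\<^sub>v conjugate v))"
proof -
  have "H *\<^sub>v (u @\<^sub>v v) =
      (A *\<^sub>v u + B *\<^sub>v v) @\<^sub>v ((- conj_mat B) *\<^sub>v u + (- conj_mat A) *\<^sub>v v)"
    unfolding H_blocks using assms by (intro four_block_mat_mult_vec[of _ n n _ n _ n]) auto
  also have "(- conj_mat B) *\<^sub>v u + (- conj_mat A) *\<^sub>v v =
      - conjugate (B *\<^sub>v conjugate u + A *\<^sub>v conjugate v)"
  proof -
    have "(- conj_mat B) *\<^sub>v u = - conjugate (B *\<^sub>v conjugate u)"
      "(- conj_mat A) *\<^sub>v v = - conjugate (A *\<^sub>v conjugate v)"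
      using assms carrier_matD[OF blocks(1)] carrier_matD[OF blocks(2)]
      by (simp_all add: conj_mat_mult[of _ n n])
    moreover have "- conjugate b + - conjugate a = - conjugate (b + a)"
      if "a \<in> carrier_vec n" "b \<in> carrier_vec n" for a b :: "complex vec"
      using that by (intro eq_vecI) auto
    moreover have "A *\<^sub>v conjugate v \<in> carrier_vec n" "B *\<^sub>v conjugate u \<in> carrier_vec n"
      using assms by (auto intro!: mult_mat_vec_carrier[of _ n n])
    ultimately show ?thesis by simp
  qed
  finally show ?thesis .
qed

text \<open>\<open>H\<close> swaps the real subspaces of vectors \<open>(u, cnj u)\<close> and \<open>(v, - cnj v)\<close>.\<close>

lemma H_square_conj_symmetric:
  assumes "conj_symmetric n x"
  shows "conj_symmetric n ((H ^\<^sub>m 2) *\<^sub>v x)"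
proof -
  obtain u where u: "u \<in> carrier_vec n" and x: "x = stack_conj u"
    using stack_vec_first[OF assms] by (metis vec_first_carrier)
  define v where "v = A *\<^sub>v u + B *\<^sub>v conjugate u"
  have v: "v \<in> carrier_vec n"
    using u blocks by (auto simp: v_def intro!: add_carrier_vec mult_mat_vec_carrier[of _ n n])
  have Av: "A *\<^sub>v v \<in> carrier_vec n" "B *\<^sub>v conjugate v \<in> carrier_vec n"
    using v blocks by (auto intro!: mult_mat_vec_carrier[of _ n n])
  have AB: "A *\<^sub>v u \<in> carrier_vec n" "B *\<^sub>v conjugate u \<in> carrier_vec n"
    using u blocks by (auto intro!: mult_mat_vec_carrier[of _ n n])
  have "H *\<^sub>v x = v @\<^sub>v (- conjugate v)"
    using u AB by (simp add: x H_mult_append v_def comm_add_vec[of _ n])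
  then have "(H ^\<^sub>m 2) *\<^sub>v x = H *\<^sub>v (v @\<^sub>v (- conjugate v))"
    using assms by (simp add: H_square_mult conj_symmetric_def)
  also have "\<dots> = (A *\<^sub>v v + B *\<^sub>v (- conjugate v)) @\<^sub>v
      (- conjugate (B *\<^sub>v conjugate v + A *\<^sub>v conjugate (- conjugate v)))"
    using v by (intro H_mult_append) auto
  also have "\<dots> = stack_conj (A *\<^sub>v v - B *\<^sub>v conjugate v)"
  proof -
    have "A *\<^sub>v v + B *\<^sub>v (- conjugate v) = A *\<^sub>v v - B *\<^sub>v conjugate v"
      using v Av by (subst mat_mult_uminus_vec[of _ n n]) auto
    moreover have "- conjugate (B *\<^sub>v conjugate v + A *\<^sub>v conjugate (- conjugate v)) =
        conjugate (A *\<^sub>v v - B *\<^sub>v conjugate v)"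
    proof -
      have "conjugate (- conjugate v) = - v"
        by (rule eq_vecI) auto
      then have "A *\<^sub>v conjugate (- conjugate v) = - (A *\<^sub>v v)"
        using v mat_mult_uminus_vec[of A n n v] by simp
      moreover have "- conjugate (b + - a) = conjugate (a - b)"
        if "a \<in> carrier_vec n" "b \<in> carrier_vec n" for a b :: "complex vec"
        using that by (intro eq_vecI) auto
      ultimately show ?thesis using Av by simp
    qed
    ultimately show ?thesis by simp
  qed
  finally show ?thesis
    using Av by (auto intro!: conj_symmetric_stack)
qed

text \<open>The two halves of \<Omega> applied to the stacked vector are conjugate to each other, so
  the inner product is a number plus its conjugate. This links the normalization of
  \<open>u\<^sub>1\<close> to the squared norm 2 of \<open>q 1\<close>.\<close>

lemma Omega_norm_stack:
  assumes u: "u \<in> carrier_vec n"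
  shows "inner_wrt \<Omega> (stack_conj u) (stack_conj u) =
    complex_of_real (2 * Re ((A *\<^sub>v u) \<bullet>c u + (B *\<^sub>v conjugate u) \<bullet>c u))"
proof -
  define v where "v = A *\<^sub>v u + B *\<^sub>v conjugate u"
  have AB: "A *\<^sub>v u \<in> carrier_vec n" "B *\<^sub>v conjugate u \<in> carrier_vec n"
    using u blocks by (auto intro!: mult_mat_vec_carrier[of _ n n])
  then have v: "v \<in> carrier_vec n" by (simp add: v_def)
  have cstack: "conjugate (stack_conj u) = conjugate u @\<^sub>v u"
    by (rule eq_vecI) auto
  have "\<Omega> *\<^sub>v stack_conj u =
      (A *\<^sub>v u + B *\<^sub>v conjugate u) @\<^sub>v (conj_mat B *\<^sub>v u + conj_mat A *\<^sub>v conjugate u)"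
    unfolding bs_Omega_def using u by (intro four_block_mat_mult_vec[of _ n n _ n _ n]) auto
  also have "conj_mat B *\<^sub>v u + conj_mat A *\<^sub>v conjugate u = conjugate v"
    using u AB by (simp add: conj_mat_mult[of _ n n] v_def conjugate_add_vec[of _ n]
        comm_add_vec[of "conjugate (A *\<^sub>v u)" n])
  finally have "inner_wrt \<Omega> (stack_conj u) (stack_conj u) = v \<bullet>c u + conjugate v \<bullet> u"
    using u v by (simp add: inner_wrt_def v_def[symmetric] cstack scalar_prod_append[of _ n _ n])
  also have "conjugate v \<bullet> u = cnj (v \<bullet>c u)"
    using u v by (simp add: scalar_prod_def)
  also have "v \<bullet>c u + cnj (v \<bullet>c u) = complex_of_real (2 * Re (v \<bullet>c u))"
    by (rule complex_add_cnj)
  also have "v \<bullet>c u = (A *\<^sub>v u) \<bullet>c u + (B *\<^sub>v conjugate u) \<bullet>c u"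
    using u AB by (simp add: v_def add_scalar_prod_distrib[of _ n])
  finally show ?thesis .
qed

end

section \<open>The Lanczos procedure for the square of a Bethe-Salpeter matrix\<close>

locale bs_lanczos = definite_bs n A B H + lanczos_run "n + n" "bs_Omega A B" "H ^\<^sub>m 2" k q
  for n A B H k q +
  assumes start_conj_symmetric: "conj_symmetric n (q 1)"
begin

lemma q_conj_symmetric_upto: "j \<le> k + 1 \<Longrightarrow> \<forall>i\<in>{1..j}. conj_symmetric n (q i)"
proof (induction j)
  case 0
  show ?case by simp
next
  case (Suc j)
  then have IH: "\<forall>i\<in>{1..j}. conj_symmetric n (q i)" by simp
  have "conj_symmetric n (q (Suc j))"
  proof (cases "j = 0")
    case True
    then show ?thesis using start_conj_symmetric by simp
  next
    case False
    then have j: "j \<in> {1..k}" using Suc.prems by auto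
    \<comment> \<open>A coefficient \<open>t i j\<close> is a priori complex;
      \<open>t_entries\<close> shows in each of its cases that it is real.\<close>
    have "conj_symmetric n (t i j \<cdot>\<^sub>v q i)" if i: "i \<in> {1..j}" for i
    proof -
      have "t i j = complex_of_real (Re (t i j))"
        using t_entries[of i j] i j by (auto split: if_splits simp: complex_eq_iff)
      then show ?thesis
        using conj_symmetric_smult_real[of n "q i" "Re (t i j)"] IH i by metis
    qed
    moreover have "conj_symmetric n ((H ^\<^sub>m 2) *\<^sub>v q j)"
      using H_square_conj_symmetric IH j by auto
    \<comment> \<open>The sum in \<open>lanczos_w\<close> lives in dimension
      \<open>dim_row M\<close>, which has to be recognized as \<open>n + n\<close> for
      \<open>conj_symmetric_finsum\<close>.\<close>
    moreover have "dim_row (H ^\<^sub>m 2) = n + n"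
      by (rule carrier_matD(1)[OF M_carrier])
    ultimately have "conj_symmetric n (w j)"
      unfolding lanczos_w_def by (auto intro!: conj_symmetric_diff conj_symmetric_finsum)
    then show ?thesis
      using conj_symmetric_smult_real[of n "w j" "1 / \<beta> j"] q_Suc[OF j] by simp
  qed
  with IH show ?case by (auto simp: le_Suc_eq)
qed

definition u :: "nat \<Rightarrow> complex vec" where
  "u j = vec_first (q j) n"

lemma u_carrier: "u j \<in> carrier_vec n"
  by (simp add: u_def)

lemma q_eq_stack:
  assumes "j \<in> {1..k + 1}"
  shows "q j = stack_conj (u j)"
  using q_conj_symmetric_upto[of "k + 1"] assms by (auto simp: u_def stack_vec_first)

text \<open>Carries \<open>matrix_recurrence\<close>, which speaks of \<open>Q\<close>, over to the
  block matrix built from the halves \<open>u j\<close>.\<close>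

lemma stack_conj_mat_u: "stack_conj_mat (mat_of_cols n (map u [1..<k + 1])) = Q"
proof (rule eq_matI)
  fix i j assume ij: "i < dim_row Q" "j < dim_col Q"
  then have "i < n + n" "j < k" using carrier_matD[OF Q_carrier] by auto
  then show "stack_conj_mat (mat_of_cols n (map u [1..<k + 1])) $$ (i, j) = Q $$ (i, j)"
    using u_carrier[of "j + 1"]
    by (auto simp: index_Q q_eq_stack append_rows_def mat_of_cols_index simp del: upt_Suc)
qed (use carrier_matD[OF Q_carrier] in \<open>auto simp: append_rows_def\<close>)

end

theorem theorem2:
  fixes n k :: nat
    and A B H \<Omega> :: "complex mat"
    and u\<^sub>1 :: "complex vec"
    and q :: "nat \<Rightarrow> complex vec"
    and \<beta> :: "nat \<Rightarrow> real"
  assumes H: "definite_bethe_salpeter n A B H"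
    and Omega: "\<Omega> = bs_Omega A B"
    and u1: "u\<^sub>1 \<in> carrier_vec n"
    and normalized: "Re ((A *\<^sub>v u\<^sub>1) \<bullet>c u\<^sub>1 + (B *\<^sub>v conjugate u\<^sub>1) \<bullet>c u\<^sub>1) = 1"
    and k: "1 \<le> k" "k < n"
    and lanczos: "lanczos_vectors (H ^\<^sub>m 2) \<Omega> (stack_conj u\<^sub>1) k q"
    and no_breakdown: "lanczos_no_breakdown (H ^\<^sub>m 2) \<Omega> k q"
    and beta: "\<beta> = lanczos_beta (H ^\<^sub>m 2) \<Omega> q"
  shows "\<exists>(u :: nat \<Rightarrow> complex vec) (\<alpha> :: nat \<Rightarrow> real) (U :: complex mat) (T :: real mat).
     u 1 = u\<^sub>1 \<and>
     (\<forall>j \<in> {1..k + 1}. u j \<in> carrier_vec n \<and> q j = stack_conj (u j)) \<and>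
     U = mat_of_cols n (map u [1..<k + 1]) \<and>
     lanczos_T (H ^\<^sub>m 2) \<Omega> q k = map_mat complex_of_real T \<and>
     (\<forall>j \<in> {1..k}. lanczos_t (H ^\<^sub>m 2) \<Omega> q j j = complex_of_real (\<alpha> j)) \<and>
     H ^\<^sub>m 2 * stack_conj_mat U =
       stack_conj_mat U * map_mat complex_of_real T +
       complex_of_real (\<beta> k) \<cdot>\<^sub>m
         (col_mat (stack_conj (u (k + 1))) * mat_adjoint (col_mat (unit_vec k (k - 1)))) \<and>
     T = sym_tridiagonal k \<alpha> \<beta> \<and>
     positive_definite T \<and>
     (\<forall>i < k. \<forall>j < k. 0 \<le> T $$ (i, j)) \<and>
     0 < \<beta> k \<and>
     (\<forall>i \<in> {1..k + 1}. \<forall>j \<in> {1..k + 1}.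
        inner_wrt \<Omega> (stack_conj (u j)) (stack_conj (u i)) = (if i = j then 2 else 0))"
proof -
  interpret definite_bs n A B H using H by unfold_locales
  have q1: "q 1 = stack_conj u\<^sub>1"
    using lanczos by (simp add: lanczos_vectors_def)
  interpret bs_lanczos n A B H k q
  proof unfold_locales
    show "H ^\<^sub>m 2 \<in> carrier_mat (n + n) (n + n)"
      by (simp add: H_square mult_carrier_mat[OF H_carrier H_carrier])
    show "conj_symmetric n (q 1)"
      unfolding q1 by (rule conj_symmetric_stack[OF u1])
    then show "q 1 \<in> carrier_vec (n + n)"
      by (simp add: conj_symmetric_def)
    \<comment> \<open>The real part assumed to be 1 is doubled by
      \<open>Omega_norm_stack\<close>.\<close>
    show "inner_wrt (bs_Omega A B) (q 1) (q 1) = 2"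
      using normalized unfolding q1 by (simp only: Omega_norm_stack[OF u1]) simp
    show "lanczos_vectors (H ^\<^sub>m 2) (bs_Omega A B) (q 1) k q"
      using lanczos by (simp only: q1 Omega)
  qed (use no_breakdown H_square_self_adjoint in \<open>simp_all only: Omega\<close>)
  \<comment> \<open>Here \<Omega> and \<beta> are variables fixed by equations; rewriting with these
    identifies them with the terms of the locales.\<close>
  note [simp] = Omega beta
  let ?T = "sym_tridiagonal k \<alpha> \<beta>"
  have u_1: "u 1 = u\<^sub>1"
    using u1 q1 by (auto simp: u_def vec_first_def intro!: eq_vecI)
  have "u j \<in> carrier_vec n \<and> q j = stack_conj (u j)" if "j \<in> {1..k + 1}" for j
    using that u_carrier q_eq_stack by blast
  moreover have "lanczos_t (H ^\<^sub>m 2) \<Omega> q j j = complex_of_real (\<alpha> j)" if "j \<in> {1..k}" for j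
    using t_entries[OF that that] by simp
  \<comment> \<open>The arguments are swapped because \<open>inner_wrt \<Omega> x y\<close> stands
    for \<open>y\<^sup>H \<Omega> x\<close>.\<close>
  moreover have "inner_wrt \<Omega> (stack_conj (u j)) (stack_conj (u i)) = (if i = j then 2 else 0)"
    if "i \<in> {1..k + 1}" "j \<in> {1..k + 1}" for i j
    using orthogonal[OF that(2,1)] q_eq_stack that by auto
  moreover have "H ^\<^sub>m 2 * stack_conj_mat (mat_of_cols n (map u [1..<k + 1])) =
      stack_conj_mat (mat_of_cols n (map u [1..<k + 1])) * map_mat complex_of_real ?T +
      complex_of_real (\<beta> k) \<cdot>\<^sub>m
        (col_mat (stack_conj (u (k + 1))) * mat_adjoint (col_mat (unit_vec k (k - 1))))"
    unfolding stack_conj_mat_u beta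
    using matrix_recurrence[OF k(1)] q_eq_stack[of "k + 1"] by simp
  moreover have "positive_definite ?T" "\<forall>i<k. \<forall>j<k. 0 \<le> ?T $$ (i, j)"
    using tridiagonal_positive_definite[OF H_square_pos] tridiagonal_nonneg[OF H_square_pos] by auto
  moreover have "0 < \<beta> k"
    using beta_pos[of k] k by simp
  ultimately show ?thesis
    using u_1 lanczos_T_tridiagonal
    by (intro exI[of _ u] exI[of _ "\<alpha>"] exI[of _ "mat_of_cols n (map u [1..<k + 1])"] exI[of _ ?T])
      auto
qed

end
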